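(* For every infinite cardinal $\kappa$ there is a primitive graph with distance sequence $1,\kappa,\kappa,\dots$ (that is, a primitive graph of infinite diameter in which, for every vertex $v$ and every integer $i\ge1$, exactly $\kappa$ vertices are at distance $i$ from $v$).
   Context: Graphs are simple and undirected, with vertex set $V(\Gamma)$. A graph $\Gamma$ is primitive if its automorphism group acts primitively on $V(\Gamma)$, i.e. the only equivalence relations on $V(\Gamma)$ invariant under $\mathrm{Aut}(\Gamma)$ are the trivial ones (equality and the universal relation). For a vertex-transitive graph, the distance sequence is $d(0),d(1),d(2),\dots$, where $d(i)$ is the (cardinal) number of vertices at graph distance exactly $i$ from a fixed vertex $v$; it does not depend on $v$. If the diameter is finite, equal to $n$, the sequence is the finite list $d(0),\dots,d(n)$. *)

theory Defs
  imports Main "HOL-Library.Extended_Nat" "Graph_Theory.Pair_Digraph"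
begin

unbundle cardinal_syntax

text \<open>
  A simple undirected graph, possibly infinite, is a symmetric and loop-free pair digraph
  (\<^locale>\<open>pair_bidirected_digraph\<close>): an edge is represented by its two opposite arcs.
  The locale \<^locale>\<open>pair_graph\<close> cannot be used, since it requires finiteness.
\<close>

definition graph_automorphism :: "'a pair_pre_digraph \<Rightarrow> ('a \<Rightarrow> 'a) \<Rightarrow> bool" where
  "graph_automorphism G f \<longleftrightarrow>
     bij_betw f (pverts G) (pverts G) \<and>
     (\<forall>u\<in>pverts G. \<forall>v\<in>pverts G. (f u, f v) \<in> parcs G \<longleftrightarrow> (u, v) \<in> parcs G)"

definition primitive_graph :: "'a pair_pre_digraph \<Rightarrow> bool" where
  "primitive_graph G \<longleftrightarrow>
     pair_bidirected_digraph G \<and>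
     (\<forall>R. equiv (pverts G) R \<longrightarrow>
          (\<forall>f. graph_automorphism G f \<longrightarrow> (\<forall>(u, v)\<in>R. (f u, f v) \<in> R)) \<longrightarrow>
          R = Id_on (pverts G) \<or> R = pverts G \<times> pverts G)"

text \<open>The distance of two vertices not joined by a walk is the infimum of the empty set, \<open>\<infinity>\<close>.\<close>

definition graph_dist :: "'a pair_pre_digraph \<Rightarrow> 'a \<Rightarrow> 'a \<Rightarrow> enat" where
  "graph_dist G u v = (INF p\<in>{p. pre_digraph.awalk (with_proj G) u p v}. enat (length p))"

definition graph_diameter :: "'a pair_pre_digraph \<Rightarrow> enat" where
  "graph_diameter G = (SUP u\<in>pverts G. SUP v\<in>pverts G. graph_dist G u v)"

definition dist_sphere :: "'a pair_pre_digraph \<Rightarrow> 'a \<Rightarrow> nat \<Rightarrow> 'a set" where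
  "dist_sphere G v i = {w \<in> pverts G. graph_dist G v w = enat i}"

end

theory Submission
  imports Defs "HOL-Algebra.Free_Abelian_Groups"
begin

text \<open>
  The graph is the halved infinite cube: its vertices are the finite subsets of even size of a set
  \<open>U\<close> of cardinality \<open>\<kappa>\<close>, two of them being adjacent when their symmetric difference has two
  elements. The distance of \<open>A\<close> and \<open>B\<close> is half the size of their symmetric difference, so the
  sphere of radius \<open>i\<close> around the empty set consists of the \<open>\<kappa>\<close> subsets of size \<open>2i\<close>.
  Translations by vertices and permutations of \<open>U\<close> are automorphisms. Hence the class of the empty
  set under an invariant equivalence relation is a permutation-invariant subgroup; if it contains a
  nonempty set \<open>A\<close>, then moving one point of \<open>A\<close> outside of \<open>A\<close> and adding the result to \<open>A\<close>
  gives a pair. All pairs then belong to the subgroup, so adjacent vertices are equivalent, and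
  connectedness makes the relation universal.
\<close>

section \<open>Sizes of symmetric differences and cardinals of families of finite sets\<close>

text \<open>Read modulo 2, this makes even size stable under symmetric difference. The additive form
  avoids truncated subtraction.\<close>

lemma card_sym_diff_add:
  assumes "finite A" "finite B"
  shows "card (sym_diff A B) + 2 * card (A \<inter> B) = card A + card B"
proof -
  have "card (sym_diff A B) = card (A - B) + card (B - A)"
    by (rule card_Un_disjoint) (use assms in auto)
  moreover have "card (A - B) + card (A \<inter> B) = card A"
    using card_Int_Diff[OF assms(1), of B] by simp
  moreover have "card (B - A) + card (A \<inter> B) = card B"
    using card_Int_Diff[OF assms(2), of A] by (simp add: Int_commute)
  ultimately show ?thesis by simp
qed

text \<open>A point separating \<open>A\<close> from \<open>C\<close> separates \<open>A\<close>
  from \<open>B\<close> or \<open>B\<close> from \<open>C\<close>.\<close>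

lemma card_sym_diff_triangle:
  assumes "finite A" "finite B" "finite C"
  shows "card (sym_diff A C) \<le> card (sym_diff A B) + card (sym_diff B C)"
proof -
  have "card (sym_diff A C) \<le> card (sym_diff A B \<union> sym_diff B C)"
    by (rule card_mono) (use assms in auto)
  also have "\<dots> \<le> card (sym_diff A B) + card (sym_diff B C)"
    by (rule card_Un_le)
  finally show ?thesis .
qed

lemma sym_diff_cancel: "sym_diff (sym_diff A C) (sym_diff B C) = sym_diff A B"
  by auto

lemma card_of_subsets_of_card:
  assumes "infinite U" "n \<ge> 1"
  shows "|{S. S \<subseteq> U \<and> finite S \<and> card S = n}| =o |U|"
proof -
  have "|{S. S \<subseteq> U \<and> finite S \<and> card S = n}| \<le>o |Fpow U|"
    by (rule card_of_mono1) (auto simp: Fpow_def)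
  then have le: "|{S. S \<subseteq> U \<and> finite S \<and> card S = n}| \<le>o |U|"
    using card_of_Fpow_infinite[OF assms(1)] ordLeq_ordIso_trans by blast
  obtain F where F: "F \<subseteq> U" "finite F" "card F = n - 1"
    using infinite_arbitrarily_large[OF assms(1)] by blast
  \<comment> \<open>Fixing \<open>n - 1\<close> points and varying the last one already yields as
    many sets as \<open>U\<close> has elements.\<close>
  have "|U - F| \<le>o |{S. S \<subseteq> U \<and> finite S \<and> card S = n}|"
  proof (rule card_of_ordLeqI[where f = "\<lambda>x. insert x F"])
    show "inj_on (\<lambda>x. insert x F) (U - F)"
      by (auto simp: inj_on_def)
  qed (use F assms(2) in auto)
  moreover have "|U - F| =o |U|"
    by (rule card_of_infinite_diff_finite[OF assms(1) F(2)])
  ultimately have "|U| \<le>o |{S. S \<subseteq> U \<and> finite S \<and> card S = n}|"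
    using ordIso_ordLeq_trans ordIso_symmetric by blast
  with le show ?thesis
    by (simp add: ordIso_iff_ordLeq)
qed

section \<open>The group of finite subsets of even size\<close>

definition even_fsets :: "'a set \<Rightarrow> 'a set set" where
  "even_fsets U = {A. A \<subseteq> U \<and> finite A \<and> even (card A)}"

lemma empty_in_even_fsets: "{} \<in> even_fsets U"
  by (simp add: even_fsets_def)

lemma sym_diff_in_even_fsets:
  assumes "A \<in> even_fsets U" "B \<in> even_fsets U"
  shows "sym_diff A B \<in> even_fsets U"
proof -
  have "even (card (sym_diff A B) + 2 * card (A \<inter> B))"
    using assms card_sym_diff_add[of A B] by (auto simp: even_fsets_def)
  then show ?thesis
    using assms by (auto simp: even_fsets_def)
qed

lemma image_in_even_fsets:
  assumes "bij_betw f U U" "A \<in> even_fsets U"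
  shows "f ` A \<in> even_fsets U"
proof -
  have "card (f ` A) = card A"
    using assms by (intro card_image) (auto simp: even_fsets_def bij_betw_def intro: inj_on_subset)
  then show ?thesis
    using assms by (auto simp: even_fsets_def bij_betw_def)
qed

text \<open>The family lies between the pairs and all finite subsets, both equinumerous with
  \<open>U\<close>. This provides the coding of vertices by elements of \<open>U\<close>.\<close>

lemma card_of_even_fsets:
  assumes "infinite U"
  shows "|even_fsets U| =o |U|"
proof -
  have "|even_fsets U| \<le>o |Fpow U|"
    by (rule card_of_mono1) (auto simp: Fpow_def even_fsets_def)
  then have "|even_fsets U| \<le>o |U|"
    using card_of_Fpow_infinite[OF assms] ordLeq_ordIso_trans by blast
  moreover have "|{S. S \<subseteq> U \<and> finite S \<and> card S = 2}| \<le>o |even_fsets U|"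
    by (rule card_of_mono1) (auto simp: even_fsets_def)
  then have "|U| \<le>o |even_fsets U|"
    using card_of_subsets_of_card[OF assms, of 2] ordIso_ordLeq_trans ordIso_symmetric
    by (metis one_le_numeral)
  ultimately show ?thesis
    by (simp add: ordIso_iff_ordLeq)
qed

text \<open>Transitivity follows the walk, and reflexivity at \<open>u\<close> covers the empty one.
  In a connected graph it thus suffices to relate adjacent vertices.\<close>

lemma equiv_walk:
  assumes "equiv V R" "pcas u p v" "set p \<subseteq> R" "u \<in> V"
  shows "(u, v) \<in> R"
  using assms(2-4)
proof (induction p arbitrary: u)
  case Nil
  then show ?case
    using assms(1) by (auto elim: equivE dest: refl_onD)
next
  case (Cons e p)
  then have e: "(u, snd e) \<in> R" by (cases e) auto
  then have "snd e \<in> V"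
    using assms(1) by (auto simp: equiv_def)
  then have "(snd e, v) \<in> R" using Cons by auto
  with e show ?case
    using assms(1) by (meson equivE transD)
qed

section \<open>The halved cube with coded vertices\<close>

text \<open>The vertices are coded by elements of \<open>U\<close> itself, since the graph has to live on its type.\<close>

locale halved_cube =
  fixes U :: "'a set" and d :: "'a \<Rightarrow> 'a set"
  assumes infinite_U: "infinite U"
    and bij_d: "bij_betw d U (even_fsets U)"
begin

definition G :: "'a pair_pre_digraph" where
  "G = \<lparr>pverts = U, parcs = {(u, v). u \<in> U \<and> v \<in> U \<and> card (sym_diff (d u) (d v)) = 2}\<rparr>"

text \<open>The decoding is meaningful only on \<open>even_fsets U\<close>.\<close>

definition e :: "'a set \<Rightarrow> 'a" where
  "e = inv_into U d"

lemma pverts_G [simp]: "pverts G = U"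
  by (simp add: G_def)

lemma parcs_G [simp]:
  "(u, v) \<in> parcs G \<longleftrightarrow> u \<in> U \<and> v \<in> U \<and> card (sym_diff (d u) (d v)) = 2"
  by (simp add: G_def)

lemma d_in: "u \<in> U \<Longrightarrow> d u \<in> even_fsets U"
  using bij_d by (auto simp: bij_betw_def)

lemma finite_d: "u \<in> U \<Longrightarrow> finite (d u)"
  using d_in by (auto simp: even_fsets_def)

lemma e_in: "A \<in> even_fsets U \<Longrightarrow> e A \<in> U"
  using bij_d by (auto simp: e_def bij_betw_def intro: inv_into_into)

lemma d_e: "A \<in> even_fsets U \<Longrightarrow> d (e A) = A"
  using bij_d by (simp add: e_def bij_betw_inv_into_right)

lemma e_d: "u \<in> U \<Longrightarrow> e (d u) = u"
  using bij_d by (simp add: e_def bij_betw_inv_into_left)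

lemma bij_e: "bij_betw e (even_fsets U) U"
  unfolding e_def by (rule bij_betw_inv_into[OF bij_d])

lemma pair_bidirected_digraph_G: "pair_bidirected_digraph G"
proof
  show "symmetric (with_proj G)"
    by (auto simp: symmetric_def sym_def Un_commute)
qed (auto simp: G_def)

section \<open>Walks, distances, spheres and diameter\<close>

lemma awalk_G: "pre_digraph.awalk (with_proj G) u p v \<longleftrightarrow> u \<in> U \<and> set p \<subseteq> parcs G \<and> pcas u p v"
  by (simp add: pre_digraph.awalk_def cas_with_proj_eq)

text \<open>Each arc changes two points, so the triangle inequality adds up along the walk.\<close>

lemma card_sym_diff_le_walk:
  assumes "pcas u p v" "set p \<subseteq> parcs G" "u \<in> U"
  shows "card (sym_diff (d u) (d v)) \<le> 2 * length p"
  using assms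
proof (induction p arbitrary: u)
  case (Cons a p)
  obtain w where a: "a = (u, w)" using Cons.prems by (cases a) auto
  have w: "w \<in> U" "card (sym_diff (d u) (d w)) = 2" and p: "pcas w p v" "set p \<subseteq> parcs G"
    using Cons.prems a by auto
  \<comment> \<open>The triangle inequality needs \<open>d v\<close> finite, so membership in
    \<open>U\<close> is carried along the walk to its end.\<close>
  have "v \<in> U"
    using p w(1)
  proof (induction p arbitrary: w)
    case (Cons b p)
    then show ?case by (cases b) auto
  qed simp
  then have "card (sym_diff (d u) (d v)) \<le> card (sym_diff (d u) (d w)) + card (sym_diff (d w) (d v))"
    by (intro card_sym_diff_triangle finite_d) (use Cons.prems w in auto)
  also have "\<dots> \<le> 2 + 2 * length p"
    using Cons.IH[OF p w(1)] w(2) by linarith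
  finally show ?case by simp
qed simp

text \<open>Changing two of the differing points at a time reaches \<open>d v\<close> in
  \<open>n\<close> steps.\<close>

lemma ex_walk:
  assumes "u \<in> U" "v \<in> U" "card (sym_diff (d u) (d v)) = 2 * n"
  shows "\<exists>p. pcas u p v \<and> set p \<subseteq> parcs G \<and> length p = n"
  using assms
proof (induction n arbitrary: u)
  case 0
  then have "sym_diff (d u) (d v) = {}"
    using finite_d by auto
  then have "d u = d v" by auto
  then have "u = v"
    using 0 e_d by metis
  then show ?case by (intro exI[of _ "[]"]) simp
next
  case (Suc n)
  have fin: "finite (sym_diff (d u) (d v))"
    using finite_d Suc.prems by auto
  obtain T where T: "T \<subseteq> sym_diff (d u) (d v)" "card T = 2"
    using obtain_subset_with_card_n[of 2 "sym_diff (d u) (d v)"] Suc.prems(3) by auto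
  have T_in: "T \<in> even_fsets U"
    using T d_in Suc.prems fin by (auto simp: even_fsets_def intro: finite_subset)
  \<comment> \<open>Toggling the two points of \<open>T\<close> in \<open>d u\<close> removes
    exactly these from the difference to \<open>d v\<close>.\<close>
  define w where "w = e (sym_diff (d u) T)"
  have "sym_diff (d u) T \<in> even_fsets U"
    using sym_diff_in_even_fsets d_in Suc.prems(1) T_in by blast
  then have w: "w \<in> U" "d w = sym_diff (d u) T"
    by (auto simp: w_def e_in d_e)
  have "sym_diff (d u) (d w) = T"
    using w(2) by auto
  then have arc: "(u, w) \<in> parcs G"
    using T Suc.prems w by simp
  have "sym_diff (d w) (d v) = sym_diff (d u) (d v) - T"
    using w(2) T by auto
  then have "card (sym_diff (d w) (d v)) = 2 * n"
    using T Suc.prems fin by (simp add: card_Diff_subset finite_subset)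
  then obtain p where "pcas w p v" "set p \<subseteq> parcs G" "length p = n"
    using Suc.IH[OF w(1) Suc.prems(2)] by blast
  with arc show ?case
    by (intro exI[of _ "(u, w) # p"]) auto
qed

lemma even_card_sym_diff:
  assumes "u \<in> U" "v \<in> U"
  shows "even (card (sym_diff (d u) (d v)))"
  using sym_diff_in_even_fsets[OF d_in[OF assms(1)] d_in[OF assms(2)]] by (simp add: even_fsets_def)

text \<open>The walk just constructed gives the upper bound, the count of changed points along any
  walk the lower one. Parity makes the halving exact.\<close>

lemma graph_dist_G:
  assumes "u \<in> U" "v \<in> U"
  shows "graph_dist G u v = enat (card (sym_diff (d u) (d v)) div 2)"
proof (rule antisym)
  obtain p where "pcas u p v" "set p \<subseteq> parcs G" "length p = card (sym_diff (d u) (d v)) div 2"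
    using ex_walk[OF assms, of "card (sym_diff (d u) (d v)) div 2"] even_card_sym_diff[OF assms]
    by auto
  then show "graph_dist G u v \<le> enat (card (sym_diff (d u) (d v)) div 2)"
    unfolding graph_dist_def using assms by (intro INF_lower2[of p]) (auto simp: awalk_G)
next
  show "enat (card (sym_diff (d u) (d v)) div 2) \<le> graph_dist G u v"
    unfolding graph_dist_def
  proof (rule INF_greatest)
    fix p
    assume "p \<in> {p. pre_digraph.awalk (with_proj G) u p v}"
    then show "enat (card (sym_diff (d u) (d v)) div 2) \<le> enat (length p)"
      using card_sym_diff_le_walk[of u p v] by (auto simp: awalk_G)
  qed
qed

lemma dist_sphere_G:
  assumes "v \<in> U"
  shows "dist_sphere G v i = {w \<in> U. card (sym_diff (d v) (d w)) = 2 * i}"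
  using even_card_sym_diff[OF assms] by (auto simp: dist_sphere_def graph_dist_G[OF assms])

lemma dist_sphere_0:
  assumes "v \<in> U"
  shows "dist_sphere G v 0 = {v}"
proof -
  have "w = v" if "w \<in> U" "card (sym_diff (d v) (d w)) = 0" for w
  proof -
    have "sym_diff (d v) (d w) = {}"
      using that finite_d assms by auto
    then have "d v = d w" by auto
    then show ?thesis using e_d assms that by metis
  qed
  then show ?thesis
    using assms by (auto simp: dist_sphere_G)
qed

text \<open>Adding \<open>d v\<close> is an involution that carries the sphere to the subsets of
  size \<open>2 * i\<close>, whose number is known.\<close>

lemma card_of_dist_sphere:
  assumes "v \<in> U" "i \<ge> 1"
  shows "|dist_sphere G v i| =o |U|"
proof -
  let ?X = "{S. S \<subseteq> U \<and> finite S \<and> card S = 2 * i}"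
  have "bij_betw (\<lambda>w. sym_diff (d v) (d w)) (dist_sphere G v i) ?X"
  proof (rule bij_betw_byWitness[where f' = "\<lambda>S. e (sym_diff (d v) S)"])
    show "\<forall>w\<in>dist_sphere G v i. e (sym_diff (d v) (sym_diff (d v) (d w))) = w"
    proof
      fix w
      assume "w \<in> dist_sphere G v i"
      moreover have "sym_diff (d v) (sym_diff (d v) (d w)) = d w"
        by auto
      ultimately show "e (sym_diff (d v) (sym_diff (d v) (d w))) = w"
        using assms by (simp only:) (simp add: dist_sphere_G e_d)
    qed
    have X: "d (e (sym_diff (d v) S)) = sym_diff (d v) S" "e (sym_diff (d v) S) \<in> U"
      if "S \<in> ?X" for S
    proof -
      have "sym_diff (d v) S \<in> even_fsets U"
        using that by (intro sym_diff_in_even_fsets d_in assms) (simp add: even_fsets_def)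
      then show "d (e (sym_diff (d v) S)) = sym_diff (d v) S" "e (sym_diff (d v) S) \<in> U"
        by (simp_all only: d_e e_in)
    qed
    have cancel: "sym_diff (d v) (sym_diff (d v) S) = S" for S
      by auto
    show "\<forall>S\<in>?X. sym_diff (d v) (d (e (sym_diff (d v) S))) = S"
      using X(1) cancel by simp
    show "(\<lambda>w. sym_diff (d v) (d w)) ` dist_sphere G v i \<subseteq> ?X"
      using assms sym_diff_in_even_fsets[OF d_in[OF assms(1)] d_in]
      by (auto simp: dist_sphere_G even_fsets_def)
    show "(\<lambda>S. e (sym_diff (d v) S)) ` ?X \<subseteq> dist_sphere G v i"
    proof
      fix w
      assume "w \<in> (\<lambda>S. e (sym_diff (d v) S)) ` ?X"
      then obtain S where S: "S \<in> ?X" "w = e (sym_diff (d v) S)"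
        by blast
      then have "sym_diff (d v) (d w) = S" "w \<in> U"
        using X[OF S(1)] cancel[of S] by (simp_all only:)
      with S(1) show "w \<in> dist_sphere G v i"
        by (simp add: dist_sphere_G[OF assms(1)])
    qed
  qed
  then have "|dist_sphere G v i| =o |?X|"
    using card_of_ordIsoI by blast
  moreover have "|?X| =o |U|"
    using card_of_subsets_of_card[OF infinite_U, of "2 * i"] assms(2) by simp
  ultimately show ?thesis
    by (rule ordIso_transitive)
qed

lemma graph_diameter_G: "graph_diameter G = \<infinity>"
proof -
  have "enat n \<le> graph_diameter G" for n
  proof -
    obtain v where v: "v \<in> U"
      using infinite_U by fastforce
    \<comment> \<open>The successor keeps the radius positive, as the cardinality of spheres
      requires.\<close>
    have "infinite (dist_sphere G v (Suc n))"
      using card_of_dist_sphere[OF v, of "Suc n"] infinite_U card_of_ordIso_finite by auto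
    then have "dist_sphere G v (Suc n) \<noteq> {}"
      by auto
    then obtain w where w: "w \<in> U" "graph_dist G v w = enat (Suc n)"
      by (auto simp: dist_sphere_def)
    have "enat n \<le> graph_dist G v w"
      using w by simp
    also have "\<dots> \<le> graph_diameter G"
      unfolding graph_diameter_def using v w by (intro SUP_upper2[of v] SUP_upper) auto
    finally show ?thesis .
  qed
  then show ?thesis
    by (metis enat_ord_simps(1) not_enat_eq not_less_eq_eq order_refl)
qed

section \<open>Automorphisms from translations and permutations\<close>

text \<open>Adjacency depends only on the size of the symmetric difference, so every bijection of
  the sets preserving that size passes through the coding.\<close>

lemma graph_automorphism_G:
  assumes "bij_betw g (even_fsets U) (even_fsets U)"
    and "\<And>A B. A \<in> even_fsets U \<Longrightarrow> B \<in> even_fsets U \<Longrightarrow>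
           card (sym_diff (g A) (g B)) = card (sym_diff A B)"
  shows "graph_automorphism G (\<lambda>u. e (g (d u)))"
proof -
  have "bij_betw (e \<circ> (g \<circ> d)) U U"
    using bij_betw_trans[OF bij_betw_trans[OF bij_d assms(1)] bij_e] .
  moreover have g_in: "g A \<in> even_fsets U" if "A \<in> even_fsets U" for A
    using assms(1) that by (auto simp: bij_betw_def)
  ultimately show ?thesis
    using assms(2) d_in e_in d_e by (simp add: graph_automorphism_def comp_def)
qed

lemma graph_automorphism_translate:
  assumes "C \<in> even_fsets U"
  shows "graph_automorphism G (\<lambda>u. e (sym_diff (d u) C))"
proof (rule graph_automorphism_G)
  show "bij_betw (\<lambda>A. sym_diff A C) (even_fsets U) (even_fsets U)"
    by (rule bij_betw_byWitness[where f' = "\<lambda>A. sym_diff A C"])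
      (use sym_diff_in_even_fsets[OF _ assms] in auto)
qed (simp only: sym_diff_cancel)

lemma graph_automorphism_permute:
  assumes "bij_betw f U U"
  shows "graph_automorphism G (\<lambda>u. e (f ` d u))"
proof (rule graph_automorphism_G)
  have inj: "inj_on f U" and surj: "f ` U = U"
    using assms by (auto simp: bij_betw_def)
  have card: "card (f ` A) = card A" if "A \<subseteq> U" for A
    using card_image inj inj_on_subset that by blast
  show "bij_betw ((`) f) (even_fsets U) (even_fsets U)"
  proof (rule bij_betw_imageI)
    show "inj_on ((`) f) (even_fsets U)"
      using inj_on_image_eq_iff[OF inj] by (auto simp: inj_on_def even_fsets_def)
    show "(`) f ` even_fsets U = even_fsets U"
    proof
      show "(`) f ` even_fsets U \<subseteq> even_fsets U"
        using image_in_even_fsets[OF assms] by auto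
      show "even_fsets U \<subseteq> (`) f ` even_fsets U"
      proof
        fix B
        assume B: "B \<in> even_fsets U"
        then have "B \<subseteq> f ` U"
          using surj by (simp add: even_fsets_def)
        then obtain A where A: "A \<subseteq> U" "B = f ` A"
          by (rule subset_imageE)
        then have "A \<in> even_fsets U"
          using B card[OF A(1)] finite_image_iff[OF inj_on_subset[OF inj A(1)]]
          by (auto simp: even_fsets_def)
        with A show "B \<in> (`) f ` even_fsets U" by blast
      qed
    qed
  qed
  fix A B
  assume "A \<in> even_fsets U" "B \<in> even_fsets U"
  then have AB: "A \<subseteq> U" "B \<subseteq> U"
    by (auto simp: even_fsets_def)
  have "sym_diff (f ` A) (f ` B) = f ` sym_diff A B"
    using AB inj_on_image_set_diff[OF inj, of A B] inj_on_image_set_diff[OF inj, of B A]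
    by (simp add: image_Un subset_trans[OF Diff_subset])
  then show "card (sym_diff (f ` A) (f ` B)) = card (sym_diff A B)"
    using card[of "sym_diff A B"] AB by auto
qed

section \<open>Primitivity\<close>

lemma primitive_graph_G: "primitive_graph G"
proof -
  have "R = U \<times> U"
    if R: "equiv U R" and inv: "\<And>f u v. graph_automorphism G f \<Longrightarrow> (u, v) \<in> R \<Longrightarrow> (f u, f v) \<in> R"
      and neq: "R \<noteq> Id_on U" for R
  proof -
    have sub: "R \<subseteq> U \<times> U"
      using R by (auto simp: equiv_def)
    \<comment> \<open>The class of the empty set, decoded into sets; it will be shown to determine
      \<open>R\<close>.\<close>
    define P where "P = {S \<in> even_fsets U. (e {}, e S) \<in> R}"
    have translate: "(e (sym_diff (d u) C), e (sym_diff (d v) C)) \<in> R"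
      if "(u, v) \<in> R" "C \<in> even_fsets U" for u v C
      using inv[OF graph_automorphism_translate[OF that(2)] that(1)] .
    \<comment> \<open>Translation by \<open>d u\<close> moves \<open>u\<close> to the empty set and
      \<open>v\<close> to the difference; translating again by \<open>d u\<close> undoes
      this.\<close>
    have R_P: "(u, v) \<in> R \<longleftrightarrow> sym_diff (d u) (d v) \<in> P" if uv: "u \<in> U" "v \<in> U" for u v
    proof
      have in_even: "sym_diff (d u) (d v) \<in> even_fsets U"
        using uv by (intro sym_diff_in_even_fsets d_in)
      have eqs: "sym_diff (d u) (d u) = {}" "sym_diff (d v) (d u) = sym_diff (d u) (d v)"
        "sym_diff {} (d u) = d u" "sym_diff (sym_diff (d u) (d v)) (d u) = d v"
        by auto
      show "sym_diff (d u) (d v) \<in> P" if "(u, v) \<in> R"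
        using translate[OF that d_in[OF uv(1)]] in_even unfolding P_def eqs by blast
      show "(u, v) \<in> R" if "sym_diff (d u) (d v) \<in> P"
      proof -
        have "(e {}, e (sym_diff (d u) (d v))) \<in> R"
          using that by (simp add: P_def)
        from translate[OF this d_in[OF uv(1)]] show ?thesis
          by (simp only: d_e[OF empty_in_even_fsets] d_e[OF in_even] eqs e_d[OF uv(1)] e_d[OF uv(2)])
      qed
    qed
    \<comment> \<open>Both sets are equivalent to the empty set, hence to each other.\<close>
    have P_sym_diff: "sym_diff A B \<in> P" if "A \<in> P" "B \<in> P" for A B
    proof -
      have AB: "A \<in> even_fsets U" "B \<in> even_fsets U"
        using that by (auto simp: P_def)
      have "(e A, e B) \<in> R"
        using that R unfolding P_def by (auto elim!: equivE intro: transD symD)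
      then show ?thesis
        using R_P[OF e_in[OF AB(1)] e_in[OF AB(2)]] AB by (simp only: d_e)
    qed
    \<comment> \<open>The automorphism induced by a permutation fixes the vertex
      \<open>e {}\<close>, so it preserves its class.\<close>
    have P_swap: "transpose a b ` A \<in> P" if "A \<in> P" "a \<in> U" "b \<in> U" for A a b
    proof -
      have A: "A \<in> even_fsets U" "(e {}, e A) \<in> R"
        using that by (auto simp: P_def)
      have bij: "bij_betw (transpose a b) U U"
        using that by (simp add: bij_betw_def)
      have "(e {}, e (transpose a b ` A)) \<in> R"
        using inv[OF graph_automorphism_permute[OF bij] A(2)]
        by (simp add: d_e A empty_in_even_fsets)
      then show ?thesis
        using image_in_even_fsets[OF bij A(1)] by (simp add: P_def)
    qed
    obtain u v where uv: "(u, v) \<in> R" "u \<noteq> v"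
      using neq R by (fastforce simp: Id_on_def equiv_def refl_on_def)
    define A where "A = sym_diff (d u) (d v)"
    have A: "A \<in> P"
      using R_P[of u v] uv sub by (auto simp: A_def)
    have "d u \<noteq> d v"
      using uv sub e_d by (metis SigmaE2 subsetD)
    then obtain a where a: "a \<in> A"
      by (auto simp: A_def)
    have "A \<subseteq> U" "finite A"
      using A by (auto simp: P_def even_fsets_def)
    moreover obtain b where b: "b \<in> U" "b \<notin> A"
      using infinite_U \<open>finite A\<close> by (meson finite_subset subsetI)
    ultimately have ab: "a \<in> U" "b \<in> U" "a \<noteq> b"
      using a by auto
    \<comment> \<open>Since \<open>a\<close> is in \<open>A\<close> and \<open>b\<close> is not, the
      swap changes \<open>A\<close> at these two points only.\<close>
    have "sym_diff A (transpose a b ` A) = {a, b}"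
      using a b by (auto simp: transpose_def image_iff)
    then have pab: "{a, b} \<in> P"
      using P_sym_diff[OF A P_swap[OF A ab(1,2)]] by simp
    \<comment> \<open>Swapping \<open>b\<close> with \<open>c\<close> fixes \<open>a\<close>, which
      differs from both.\<close>
    have pac: "{a, c} \<in> P" if "c \<in> U" "c \<noteq> a" for c
    proof (cases "c = b")
      case False
      then have "transpose b c ` {a, b} = {a, c}"
        using that ab by simp
      then show ?thesis
        using P_swap[OF pab ab(2) that(1)] by simp
    qed (use pab in simp)
    have pairs: "{c, c'} \<in> P" if "c \<in> U" "c' \<in> U" "c \<noteq> c'" for c c'
    proof (cases "c = a \<or> c' = a")
      case True
      then show ?thesis
        using pac[of c] pac[of c'] that by (metis insert_commute)
    next
      case False
      \<comment> \<open>Two pairs through \<open>a\<close> add up to a pair avoiding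
        \<open>a\<close>.\<close>
      then have "sym_diff {a, c} {a, c'} = {c, c'}"
        using that by auto
      then show ?thesis
        using P_sym_diff[OF pac pac] that False by metis
    qed
    have "parcs G \<subseteq> R"
    proof (rule subrelI)
      fix x y
      assume "(x, y) \<in> parcs G"
      then have xy: "x \<in> U" "y \<in> U" "card (sym_diff (d x) (d y)) = 2"
        by auto
      then obtain c c' where c: "sym_diff (d x) (d y) = {c, c'}" "c \<noteq> c'"
        by (meson card_2_iff)
      moreover have "sym_diff (d x) (d y) \<subseteq> U"
        using d_in xy by (auto simp: even_fsets_def)
      ultimately have "sym_diff (d x) (d y) \<in> P"
        using pairs by simp
      then show "(x, y) \<in> R"
        using R_P xy by blast
    qed
    have "(x, y) \<in> R" if xy: "x \<in> U" "y \<in> U" for x y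
    proof -
      obtain p where "pcas x p y" "set p \<subseteq> parcs G"
        using ex_walk[OF xy] even_card_sym_diff[OF xy] by (metis evenE)
      with \<open>parcs G \<subseteq> R\<close> show ?thesis
        by (intro equiv_walk[OF R _ _ xy(1)]) auto
    qed
    with sub show ?thesis by auto
  qed
  then have "R = Id_on U \<or> R = U \<times> U"
    if "equiv U R" "\<forall>f. graph_automorphism G f \<longrightarrow> (\<forall>(u, v)\<in>R. (f u, f v) \<in> R)" for R
    using that by fast
  then show ?thesis
    by (simp add: primitive_graph_def pair_bidirected_digraph_G)
qed

end

theorem theorem2p2:
  fixes \<kappa> :: "'a rel"
  assumes "Card_order \<kappa>" and "cinfinite \<kappa>"
  shows "\<exists>G :: 'a pair_pre_digraph.
           primitive_graph G \<and>
           graph_diameter G = \<infinity> \<and>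
           (\<forall>v\<in>pverts G.
              |dist_sphere G v 0| =o cone \<and>
              (\<forall>i\<ge>1. |dist_sphere G v i| =o \<kappa>))"
proof -
  let ?U = "Field \<kappa>"
  have inf: "infinite ?U"
    using assms(2) by (simp add: cinfinite_def)
  \<comment> \<open>Equinumerosity supplies a coding with vertex set all of
    \<open>Field \<kappa>\<close>, which keeps the graph on the type of
    \<open>\<kappa>\<close>.\<close>
  obtain d where "bij_betw d ?U (even_fsets ?U)"
    using card_of_even_fsets[OF inf] card_of_ordIso ordIso_symmetric by blast
  then interpret halved_cube ?U d
    using inf by unfold_locales
  have "|dist_sphere G v 0| =o cone" if "v \<in> ?U" for v
    unfolding dist_sphere_0[OF that] cone_def
    by (rule card_of_ordIsoI[of "\<lambda>_. ()"]) (simp add: bij_betw_def)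
  moreover have "|dist_sphere G v i| =o \<kappa>" if "v \<in> ?U" "i \<ge> 1" for v i
    using card_of_dist_sphere[OF that] card_of_Field_ordIso[OF assms(1)] ordIso_transitive by blast
  ultimately show ?thesis
    using primitive_graph_G graph_diameter_G by (intro exI[of _ G]) auto
qed

end
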